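(* Let $k$ be a field of characteristic zero, $G$ a finite group, and $A$ an associative $k$-algebra equipped with an action of $G$. Let $n\ge 1$ and let $m_t=m_0+m_1t+\cdots+m_nt^n$ (modulo $t^{n+1}$) be an equivariant formal one-parameter deformation of $(G,A)$ of order $n$. Let $F\colon A^{\otimes 3}\to A$ be the $(n+1)$-th obstruction cochain, that is, the $k$-linear map $$F(a,b,c)=\sum_{\substack{p+q=n+1\\ p,q>0}} \bigl(m_p(m_q(a,b),c)-m_p(a,m_q(b,c))\bigr),\qquad a,b,c\in A.$$ Then $F$ is a $3$-cocycle in the equivariant Hochschild complex $C^\sharp_G(A;A)$, and the given deformation of order $n$ extends to an equivariant deformation of order $n+1$ (that is, there is $m_{n+1}\in \mathrm{Hom}^G_k(A\otimes A,A)$ such that $m_0+m_1t+\cdots+m_nt^n+m_{n+1}t^{n+1}$ is an equivariant deformation of $(G,A)$ of order $n+1$) if and only if the cohomology class of $F$ in $H^3_G(A;A)$ vanishes.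
   Context: Algebras are not assumed unital; $\otimes=\otimes_k$. An action of $G$ on an associative $k$-algebra $A$, denoted $(G,A)$, is a left action of $G$ on the set $A$ such that each $a\mapsto ga$ is $k$-linear and $(ga)(gb)=g(ab)$ for all $g\in G$, $a,b\in A$. $\mathrm{Hom}^G_k(A\otimes A,A)$ denotes the space of $k$-bilinear maps $m\colon A\times A\to A$ with $m(ga,gb)=g\,m(a,b)$ for all $g\in G$, $a,b\in A$. An equivariant formal one-parameter deformation of $(G,A)$ of order $n$ is $m_t=\sum_{i=0}^n m_it^i$ (modulo $t^{n+1}$), where $m_0(a,b)=ab$ is the original multiplication, $m_i\in\mathrm{Hom}^G_k(A\otimes A,A)$ for all $1\le i\le n$, and $m_t$ is associative modulo $t^{n+1}$, i.e. for every $0\le r\le n$ and all $a,b,c\in A$, $$\sum_{p+q=r,\ p,q\ge 0}\bigl(m_p(m_q(a,b),c)-m_p(a,m_q(b,c))\bigr)=0.$$ Equivariant Hochschild complex: for $n\ge1$, $C^n(A;A)=\mathrm{Hom}_k(A^{\otimes n},A)$ with coboundary $$\delta(f)(x_1,\dots,x_{n+1})=x_1f(x_2,\dots,x_{n+1})+\sum_{i=1}^{n}(-1)^if(x_1,\dots,x_ix_{i+1},\dots,x_{n+1})+(-1)^{n+1}f(x_1,\dots,x_n)x_{n+1}.$$ $C^n_G(A;A)\subseteq C^n(A;A)$ is the subspace of cochains $c$ with $c(ga_1,\dots,ga_n)=g\,c(a_1,\dots,a_n)$ for all $g\in G$; the coboundary $\delta$ restricts to $C^\sharp_G(A;A)$,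 and $H^n_G(A;A)$ is the $n$-th cohomology of $(C^\sharp_G(A;A),\delta)$. *)

theory Defs
  imports Complex_Main "HOL-Algebra.Group_Action"
begin

text \<open>
  An associative, not necessarily unital algebra over a field: the class \<open>ring\<close> does not
  provide a unit element.
\<close>

locale nonunital_algebra = vector_space scale
  for scale :: "'k::field \<Rightarrow> 'a::ring \<Rightarrow> 'a" +
  assumes scale_mult_left: "scale c a * b = scale c (a * b)"
    and scale_mult_right: "a * scale c b = scale c (a * b)"

locale algebra_action =
  nonunital_algebra scale + group_action G UNIV \<phi>
  for scale :: "'k::field \<Rightarrow> 'a::ring \<Rightarrow> 'a"
    and G :: "('g, 'b) monoid_scheme"
    and \<phi> :: "'g \<Rightarrow> 'a \<Rightarrow> 'a" +
  assumes act_linear: "g \<in> carrier G \<Longrightarrow> Vector_Spaces.linear scale scale (\<phi> g)"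
    and act_mult: "g \<in> carrier G \<Longrightarrow> \<phi> g a * \<phi> g b = \<phi> g (a * b)"


subsection \<open>Equivariant deformations\<close>

definition equivariant_bilinear ::
  "('k::field \<Rightarrow> 'a::ring \<Rightarrow> 'a) \<Rightarrow> ('g, 'b) monoid_scheme \<Rightarrow> ('g \<Rightarrow> 'a \<Rightarrow> 'a)
    \<Rightarrow> ('a \<Rightarrow> 'a \<Rightarrow> 'a) set" where
  "equivariant_bilinear scale G \<phi> =
    {m. (\<forall>a. Vector_Spaces.linear scale scale (\<lambda>b. m a b)) \<and>
        (\<forall>b. Vector_Spaces.linear scale scale (\<lambda>a. m a b)) \<and>
        (\<forall>g\<in>carrier G. \<forall>a b. m (\<phi> g a) (\<phi> g b) = \<phi> g (m a b))}"

text \<open>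
  A deformation of order \<open>n\<close> is given by the coefficients \<open>m 0, \<dots>, m n\<close>; the values of \<open>m\<close>
  at indices above \<open>n\<close> are irrelevant.
\<close>

definition equivariant_deformation ::
  "('k::field \<Rightarrow> 'a::ring \<Rightarrow> 'a) \<Rightarrow> ('g, 'b) monoid_scheme \<Rightarrow> ('g \<Rightarrow> 'a \<Rightarrow> 'a)
    \<Rightarrow> nat \<Rightarrow> (nat \<Rightarrow> 'a \<Rightarrow> 'a \<Rightarrow> 'a) \<Rightarrow> bool" where
  "equivariant_deformation scale G \<phi> n m \<longleftrightarrow>
    m 0 = (\<lambda>a b. a * b) \<and>
    (\<forall>i\<in>{1..n}. m i \<in> equivariant_bilinear scale G \<phi>) \<and>
    (\<forall>r\<le>n. \<forall>a b c.
      (\<Sum>(p, q)\<in>{(p, q). p + q = r}. m p (m q a b) c - m p a (m q b c)) = 0)"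


subsection \<open>The equivariant Hochschild complex\<close>

text \<open>
  An \<open>n\<close>-cochain is a function on argument lists that is linear in each of \<open>n\<close> arguments; it
  is required to vanish on lists of any other length, so that cochains are equal iff they
  agree on all \<open>n\<close>-tuples. The complex starts in degree 1, hence is zero in degree 0.
\<close>

definition hochschild_cochains :: "('k::field \<Rightarrow> 'a::ring \<Rightarrow> 'a) \<Rightarrow> nat \<Rightarrow> ('a list \<Rightarrow> 'a) set" where
  "hochschild_cochains scale n =
    {f. (\<forall>xs ys. length xs + 1 + length ys = n \<longrightarrow>
           Vector_Spaces.linear scale scale (\<lambda>a. f (xs @ [a] @ ys))) \<and>
        (\<forall>xs. length xs \<noteq> n \<longrightarrow> f xs = 0) \<and>
        (n = 0 \<longrightarrow> f = (\<lambda>_. 0))}"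

text \<open>
  The coboundary of an \<open>n\<close>-cochain. List positions count from 0, so \<open>xs ! (i - 1)\<close> is the
  argument usually called \<open>x\<^sub>i\<close>. The signs are taken in the field, since the algebra may
  lack a unit.
\<close>

definition hochschild_d ::
  "('k::field \<Rightarrow> 'a::ring \<Rightarrow> 'a) \<Rightarrow> nat \<Rightarrow> ('a list \<Rightarrow> 'a) \<Rightarrow> 'a list \<Rightarrow> 'a" where
  "hochschild_d scale n f xs =
    (if length xs = n + 1 then
       hd xs * f (tl xs)
       + (\<Sum>i = 1..n. scale ((-1) ^ i)
            (f (take (i - 1) xs @ [xs ! (i - 1) * xs ! i] @ drop (i + 1) xs)))
       + scale ((-1) ^ (n + 1)) (f (butlast xs) * last xs)
     else 0)"

definition equivariant_cochains ::
  "('k::field \<Rightarrow> 'a::ring \<Rightarrow> 'a) \<Rightarrow> ('g, 'b) monoid_scheme \<Rightarrow> ('g \<Rightarrow> 'a \<Rightarrow> 'a)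
    \<Rightarrow> nat \<Rightarrow> ('a list \<Rightarrow> 'a) set" where
  "equivariant_cochains scale G \<phi> n =
    {f \<in> hochschild_cochains scale n.
       \<forall>g\<in>carrier G. \<forall>xs. length xs = n \<longrightarrow> f (map (\<phi> g) xs) = \<phi> g (f xs)}"

definition equivariant_cocycles ::
  "('k::field \<Rightarrow> 'a::ring \<Rightarrow> 'a) \<Rightarrow> ('g, 'b) monoid_scheme \<Rightarrow> ('g \<Rightarrow> 'a \<Rightarrow> 'a)
    \<Rightarrow> nat \<Rightarrow> ('a list \<Rightarrow> 'a) set" where
  "equivariant_cocycles scale G \<phi> n =
    {f \<in> equivariant_cochains scale G \<phi> n. hochschild_d scale n f = (\<lambda>_. 0)}"

definition equivariant_coboundaries ::
  "('k::field \<Rightarrow> 'a::ring \<Rightarrow> 'a) \<Rightarrow> ('g, 'b) monoid_scheme \<Rightarrow> ('g \<Rightarrow> 'a \<Rightarrow> 'a)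
    \<Rightarrow> nat \<Rightarrow> ('a list \<Rightarrow> 'a) set" where
  "equivariant_coboundaries scale G \<phi> n =
    (if n = 0 then {\<lambda>_. 0}
     else hochschild_d scale (n - 1) ` equivariant_cochains scale G \<phi> (n - 1))"

text \<open>
  Cocycles and cohomology as additive groups, written with the multiplicative record fields of
  \<open>HOL-Algebra\<close>; thus \<open>\<one>\<close> of the cohomology group is its zero class. The scalar action plays no
  role for the vanishing of a class.
\<close>

definition equivariant_cocycle_group ::
  "('k::field \<Rightarrow> 'a::ring \<Rightarrow> 'a) \<Rightarrow> ('g, 'b) monoid_scheme \<Rightarrow> ('g \<Rightarrow> 'a \<Rightarrow> 'a)
    \<Rightarrow> nat \<Rightarrow> ('a list \<Rightarrow> 'a) monoid" where
  "equivariant_cocycle_group scale G \<phi> n =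
    \<lparr>carrier = equivariant_cocycles scale G \<phi> n,
     monoid.mult = (\<lambda>f h xs. f xs + h xs),
     one = (\<lambda>_. 0)\<rparr>"

definition equivariant_cohomology ::
  "('k::field \<Rightarrow> 'a::ring \<Rightarrow> 'a) \<Rightarrow> ('g, 'b) monoid_scheme \<Rightarrow> ('g \<Rightarrow> 'a \<Rightarrow> 'a)
    \<Rightarrow> nat \<Rightarrow> ('a list \<Rightarrow> 'a) set monoid" where
  "equivariant_cohomology scale G \<phi> n =
    equivariant_cocycle_group scale G \<phi> n Mod equivariant_coboundaries scale G \<phi> n"

definition cohomology_class ::
  "('k::field \<Rightarrow> 'a::ring \<Rightarrow> 'a) \<Rightarrow> ('g, 'b) monoid_scheme \<Rightarrow> ('g \<Rightarrow> 'a \<Rightarrow> 'a)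
    \<Rightarrow> nat \<Rightarrow> ('a list \<Rightarrow> 'a) \<Rightarrow> ('a list \<Rightarrow> 'a) set" where
  "cohomology_class scale G \<phi> n f =
    equivariant_coboundaries scale G \<phi> n #>\<^bsub>equivariant_cocycle_group scale G \<phi> n\<^esub> f"


subsection \<open>The obstruction cochain\<close>

definition obstruction :: "nat \<Rightarrow> (nat \<Rightarrow> 'a \<Rightarrow> 'a \<Rightarrow> 'a::ring) \<Rightarrow> 'a list \<Rightarrow> 'a" where
  "obstruction n m xs =
    (case xs of
       [a, b, c] \<Rightarrow>
         (\<Sum>(p, q)\<in>{(p, q). p + q = n + 1 \<and> 0 < p \<and> 0 < q}.
            m p (m q a b) c - m p a (m q b c))
     | _ \<Rightarrow> 0)"

end

theory Submission
  imports Defs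
begin

text \<open>
  In a nonassociative ring the associator \<open>(a,b,c) = (ab)c - a(bc)\<close> satisfies the pentagon
  identity \<open>a(b,c,d) - (ab,c,d) + (a,bc,d) - (a,b,cd) + (a,b,c)d = 0\<close>. For the power series
  product with coefficients \<open>m 0, \<dots>, m n, 0, 0, \<dots>\<close>, the associator has coefficients 0 up to
  degree \<open>n\<close>, and its coefficient of degree \<open>n + 1\<close> is the obstruction \<open>F\<close>; so the coefficient
  of degree \<open>n + 1\<close> of the pentagon identity is \<open>\<delta>F = 0\<close>. A further coefficient \<open>\<mu>\<close> in degree
  \<open>n + 1\<close> changes the associator in that degree from \<open>F\<close> to \<open>F - \<delta>\<mu>\<close>.
\<close>

section \<open>The pentagon identity\<close>

text \<open>Coefficient of degree \<open>r\<close> in the associator of the product with series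
  \<open>m\<close>. The values lie in a mere abelian group, so the ring product can enter only as
  \<open>m 0\<close>.\<close>

definition associator_coeff ::
  "(nat \<Rightarrow> 'a \<Rightarrow> 'a \<Rightarrow> 'a::ab_group_add) \<Rightarrow> nat \<Rightarrow> 'a \<Rightarrow> 'a \<Rightarrow> 'a \<Rightarrow> 'a" where
  "associator_coeff m r a b c =
    (\<Sum>(p, q)\<in>{(p, q). p + q = r}. m p (m q a b) c - m p a (m q b c))"

lemma finite_antidiagonal: "finite {(p, q). p + q = (r::nat)}"
  by (rule finite_subset[of _ "{..r} \<times> {..r}"]) auto

text \<open>Composing an associator coefficient with one more \<open>m p\<close> produces a sum over
  pairs inside a sum over pairs. Flattening it to triples makes the symmetry of the three indices
  available.\<close>

lemma sum_antidiagonal_nested: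
  fixes f :: "nat \<Rightarrow> nat \<Rightarrow> nat \<Rightarrow> 'a::comm_monoid_add"
  shows "(\<Sum>(p, q)\<in>{(p, q). p + q = N}. \<Sum>(r, s)\<in>{(r, s). r + s = q}. f p r s)
    = (\<Sum>(p, r, s)\<in>{(p, r, s). p + r + s = N}. f p r s)"
proof -
  have "(\<Sum>(p, q)\<in>{(p, q). p + q = N}. \<Sum>(r, s)\<in>{(r, s). r + s = q}. f p r s)
    = (\<Sum>x\<in>{(p, q). p + q = N}. \<Sum>y\<in>{(r, s). r + s = snd x}. f (fst x) (fst y) (snd y))"
    by (simp add: case_prod_unfold)
  also have "\<dots> = (\<Sum>(x, y)\<in>(SIGMA x:{(p, q). p + q = N}. {(r, s). r + s = snd x}).
      f (fst x) (fst y) (snd y))"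
    by (intro sum.Sigma ballI finite_antidiagonal)
  also have "\<dots> = (\<Sum>(p, r, s)\<in>{(p, r, s). p + r + s = N}. f p r s)"
    by (rule sum.reindex_bij_witness[where j = "\<lambda>(x, r, s). (fst x, r, s)"
          and i = "\<lambda>(p, r, s). ((p, r + s), r, s)"]) auto
  finally show ?thesis .
qed

lemma sum_antidiagonal3_rotate:
  fixes f :: "nat \<Rightarrow> nat \<Rightarrow> nat \<Rightarrow> 'a::comm_monoid_add"
  shows "(\<Sum>(p, r, s)\<in>{(p, r, s). p + r + s = N}. f r s p)
    = (\<Sum>(p, r, s)\<in>{(p, r, s). p + r + s = N}. f p r s)"
  by (rule sum.reindex_bij_witness[where j = "\<lambda>(p, r, s). (r, s, p)"
        and i = "\<lambda>(p, r, s). (s, p, r)"]) auto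

lemma sum_antidiagonal3_swap:
  fixes f :: "nat \<Rightarrow> nat \<Rightarrow> nat \<Rightarrow> 'a::comm_monoid_add"
  shows "(\<Sum>(p, r, s)\<in>{(p, r, s). p + r + s = N}. f r p s)
    = (\<Sum>(p, r, s)\<in>{(p, r, s). p + r + s = N}. f p r s)"
  by (rule sum.reindex_bij_witness[where j = "\<lambda>(p, r, s). (r, p, s)"
        and i = "\<lambda>(p, r, s). (r, p, s)"]) auto

text \<open>Biadditivity moves the outer \<open>m p\<close> inside the associators, which leaves ten
  triple products. Each of the five bracketings of \<open>a\<close>, \<open>b\<close>,
  \<open>c\<close>, \<open>d\<close> occurs twice, with opposite signs and permuted indices.\<close>

lemma associator_coeff_pentagon:
  fixes m :: "nat \<Rightarrow> 'a \<Rightarrow> 'a \<Rightarrow> 'a::ab_group_add"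
  assumes left: "\<And>p c. additive (\<lambda>x. m p x c)"
    and right: "\<And>p a. additive (m p a)"
  shows "(\<Sum>(p, q)\<in>{(p, q). p + q = N}.
      m p a (associator_coeff m q b c d) - associator_coeff m q (m p a b) c d
      + associator_coeff m q a (m p b c) d - associator_coeff m q a b (m p c d)
      + m p (associator_coeff m q a b c) d) = 0"
proof -
  let ?T = "{(p, r, s). p + r + s = N}"
  let ?S = "\<lambda>f. \<Sum>(p, r, s)\<in>?T. f p r s :: 'a"
  have "(\<Sum>(p, q)\<in>{(p, q). p + q = N}.
      m p a (associator_coeff m q b c d) - associator_coeff m q (m p a b) c d
      + associator_coeff m q a (m p b c) d - associator_coeff m q a b (m p c d)
      + m p (associator_coeff m q a b c) d)
    = (\<Sum>(p, q)\<in>{(p, q). p + q = N}. \<Sum>(r, s)\<in>{(r, s). r + s = q}.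
      m p a (m r (m s b c) d) - m p a (m r b (m s c d))
      - (m r (m s (m p a b) c) d - m r (m p a b) (m s c d))
      + (m r (m s a (m p b c)) d - m r a (m s (m p b c) d))
      - (m r (m s a b) (m p c d) - m r a (m s b (m p c d)))
      + (m p (m r (m s a b) c) d - m p (m r a (m s b c)) d))"
    unfolding associator_coeff_def case_prod_unfold
      additive.sum[OF left] additive.sum[OF right] additive.diff[OF left] additive.diff[OF right]
    by (simp only: sum.distrib sum_subtractf)
  also have "\<dots> = ?S (\<lambda>p r s.
      m p a (m r (m s b c) d) - m p a (m r b (m s c d))
      - (m r (m s (m p a b) c) d - m r (m p a b) (m s c d))
      + (m r (m s a (m p b c)) d - m r a (m s (m p b c) d))
      - (m r (m s a b) (m p c d) - m r a (m s b (m p c d)))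
      + (m p (m r (m s a b) c) d - m p (m r a (m s b c)) d))"
    by (rule sum_antidiagonal_nested)
  also have "\<dots> = ?S (\<lambda>p r s. m p a (m r (m s b c) d)) - ?S (\<lambda>p r s. m p a (m r b (m s c d)))
      - (?S (\<lambda>p r s. m r (m s (m p a b) c) d) - ?S (\<lambda>p r s. m r (m p a b) (m s c d)))
      + (?S (\<lambda>p r s. m r (m s a (m p b c)) d) - ?S (\<lambda>p r s. m r a (m s (m p b c) d)))
      - (?S (\<lambda>p r s. m r (m s a b) (m p c d)) - ?S (\<lambda>p r s. m r a (m s b (m p c d))))
      + (?S (\<lambda>p r s. m p (m r (m s a b) c) d) - ?S (\<lambda>p r s. m p (m r a (m s b c)) d))"
    unfolding case_prod_unfold by (simp only: sum.distrib sum_subtractf)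
  \<comment> \<open>Renaming indices brings the two copies of each bracketing to the same form. A
    rotation suffices for four of them; for \<open>(ab)(cd)\<close> one copy is rotated and the
    other has its first two indices swapped.\<close>
  also have "\<dots> = 0"
    using sum_antidiagonal3_rotate[of "\<lambda>p r s. m p a (m r (m s b c) d)" N]
      sum_antidiagonal3_rotate[of "\<lambda>p r s. m p a (m r b (m s c d))" N]
      sum_antidiagonal3_rotate[of "\<lambda>p r s. m p (m r (m s a b) c) d" N]
      sum_antidiagonal3_rotate[of "\<lambda>p r s. m p (m r a (m s b c)) d" N]
      sum_antidiagonal3_rotate[of "\<lambda>p r s. m p (m r a b) (m s c d)" N]
      sum_antidiagonal3_swap[of "\<lambda>p r s. m p (m r a b) (m s c d)" N]
    by simp
  finally show ?thesis .
qed

section \<open>The equivariant Hochschild complex in low degrees\<close>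

lemma linear_imp_additive:
  "Vector_Spaces.linear s1 s2 f \<Longrightarrow> additive f"
  by (simp add: additive_def Vector_Spaces.linear_iff)

lemma length_3_conv: "length xs = 3 \<longleftrightarrow> (\<exists>a b c. xs = [a, b, c])"
  by (auto simp: eval_nat_numeral length_Suc_conv)

text \<open>Lists the possible contexts of the varying argument in the linearity clause of
  \<open>hochschild_cochains\<close>.\<close>

lemma length_split_2:
  "length xs + 1 + length ys = 2 \<longleftrightarrow> (\<exists>a. xs = [] \<and> ys = [a]) \<or> (\<exists>a. xs = [a] \<and> ys = [])"
  by (cases xs) (auto simp: eval_nat_numeral length_Suc_conv)

lemma length_split_3:
  "length xs + 1 + length ys = 3 \<longleftrightarrow> (\<exists>a b. xs = [] \<and> ys = [a, b])
    \<or> (\<exists>a b. xs = [a] \<and> ys = [b]) \<or> (\<exists>a b. xs = [a, b] \<and> ys = [])"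
  \<comment> \<open>\<open>remdups_adj.cases\<close> supplies the split into lists of length 0, 1
    and at least 2.\<close>
  by (cases xs rule: remdups_adj.cases) (auto simp: eval_nat_numeral length_Suc_conv)

context algebra_action
begin

lemma vector_space_scale: "vector_space scale"
  by unfold_locales

lemma linear_mult_left: "Vector_Spaces.linear scale scale (\<lambda>a. a * b)"
  by (simp add: Vector_Spaces.linear_iff vector_space_scale distrib_right scale_mult_left)

lemma linear_mult_right: "Vector_Spaces.linear scale scale (\<lambda>b. a * b)"
  by (simp add: Vector_Spaces.linear_iff vector_space_scale distrib_left scale_mult_right)

lemma times_equivariant_bilinear: "(\<lambda>a b. a * b) \<in> equivariant_bilinear scale G \<phi>"
  by (simp add: equivariant_bilinear_def linear_mult_left linear_mult_right act_mult)

lemma linear_zero: "Vector_Spaces.linear scale scale (\<lambda>a. 0)"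
  by (simp add: Vector_Spaces.linear_iff vector_space_scale)

lemma act_additive: "g \<in> carrier G \<Longrightarrow> additive (\<phi> g)"
  using act_linear by (rule linear_imp_additive)

lemma act_zero: "g \<in> carrier G \<Longrightarrow> \<phi> g 0 = 0"
  by (rule additive.zero[OF act_additive])

text \<open>Allows a deformation to be padded with zero coefficients above its order.\<close>

lemma zero_equivariant_bilinear: "(\<lambda>a b. 0) \<in> equivariant_bilinear scale G \<phi>"
  by (simp add: equivariant_bilinear_def linear_zero act_zero)

lemma hochschild_d_2:
  "hochschild_d scale 2 f [a, b, c]
    = a * f [b, c] - f [a * b, c] + f [a, b * c] - f [a, b] * c"
  by (simp add: hochschild_d_def eval_nat_numeral)

lemma hochschild_d_3:
  "hochschild_d scale 3 f [a, b, c, d]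
    = a * f [b, c, d] - f [a * b, c, d] + f [a, b * c, d] - f [a, b, c * d] + f [a, b, c] * d"
  by (simp add: hochschild_d_def eval_nat_numeral)

section \<open>Cochains and coboundaries as additive groups\<close>

lemma equivariant_cochains_zero: "(\<lambda>_. 0) \<in> equivariant_cochains scale G \<phi> n"
  by (simp add: equivariant_cochains_def hochschild_cochains_def linear_zero act_zero)

lemma equivariant_cochains_add:
  assumes "f \<in> equivariant_cochains scale G \<phi> n" "h \<in> equivariant_cochains scale G \<phi> n"
  shows "(\<lambda>xs. f xs + h xs) \<in> equivariant_cochains scale G \<phi> n"
  using assms
  by (auto simp: equivariant_cochains_def hochschild_cochains_def Vector_Spaces.linear_iff
      additive.add[OF act_additive] scale_right_distrib algebra_simps)

lemma equivariant_cochains_diff: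
  assumes "f \<in> equivariant_cochains scale G \<phi> n" "h \<in> equivariant_cochains scale G \<phi> n"
  shows "(\<lambda>xs. f xs - h xs) \<in> equivariant_cochains scale G \<phi> n"
  using assms
  by (auto simp: equivariant_cochains_def hochschild_cochains_def Vector_Spaces.linear_iff
      additive.diff[OF act_additive] scale_right_diff_distrib algebra_simps)

lemma hochschild_d_zero: "hochschild_d scale n (\<lambda>_. 0) = (\<lambda>_. 0)"
  by (simp add: hochschild_d_def fun_eq_iff)

lemma hochschild_d_add:
  "hochschild_d scale n (\<lambda>xs. f xs + h xs)
    = (\<lambda>xs. hochschild_d scale n f xs + hochschild_d scale n h xs)"
  by (simp add: hochschild_d_def fun_eq_iff algebra_simps scale_right_distrib sum.distrib)

lemma hochschild_d_diff:
  "hochschild_d scale n (\<lambda>xs. f xs - h xs)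
    = (\<lambda>xs. hochschild_d scale n f xs - hochschild_d scale n h xs)"
  by (simp add: hochschild_d_def fun_eq_iff algebra_simps scale_right_diff_distrib sum_subtractf)

lemma equivariant_coboundaries_zero: "(\<lambda>_. 0) \<in> equivariant_coboundaries scale G \<phi> n"
  using equivariant_cochains_zero hochschild_d_zero[of "n - 1"]
  by (auto simp: equivariant_coboundaries_def image_iff intro!: bexI)

lemma equivariant_coboundaries_add:
  assumes "f \<in> equivariant_coboundaries scale G \<phi> n" "h \<in> equivariant_coboundaries scale G \<phi> n"
  shows "(\<lambda>xs. f xs + h xs) \<in> equivariant_coboundaries scale G \<phi> n"
  using assms
  by (auto simp: equivariant_coboundaries_def hochschild_d_add[symmetric]
      intro!: imageI equivariant_cochains_add split: if_splits)

lemma equivariant_coboundaries_diff: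
  assumes "f \<in> equivariant_coboundaries scale G \<phi> n" "h \<in> equivariant_coboundaries scale G \<phi> n"
  shows "(\<lambda>xs. f xs - h xs) \<in> equivariant_coboundaries scale G \<phi> n"
  using assms
  by (auto simp: equivariant_coboundaries_def hochschild_d_diff[symmetric]
      intro!: imageI equivariant_cochains_diff split: if_splits)

text \<open>The zero of the factor group is the subgroup of coboundaries itself, so the question is
  when the coset of \<open>f\<close> equals that subgroup. Closure under zero, sums and differences
  decides it.\<close>

lemma cohomology_class_eq_one_iff:
  "cohomology_class scale G \<phi> n f = \<one>\<^bsub>equivariant_cohomology scale G \<phi> n\<^esub>
    \<longleftrightarrow> f \<in> equivariant_coboundaries scale G \<phi> n"
proof -
  let ?B = "equivariant_coboundaries scale G \<phi> n"
  have coset: "cohomology_class scale G \<phi> n f = (\<lambda>h xs. h xs + f xs) ` ?B"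
    by (auto simp: cohomology_class_def r_coset_def equivariant_cocycle_group_def)
  have one: "\<one>\<^bsub>equivariant_cohomology scale G \<phi> n\<^esub> = ?B"
    by (simp add: equivariant_cohomology_def FactGroup_def)
  show ?thesis
    unfolding coset one
  proof
    assume "(\<lambda>h xs. h xs + f xs) ` ?B = ?B"
    \<comment> \<open>The zero coboundary shows that \<open>f\<close> lies in its own coset.\<close>
    moreover have "(\<lambda>xs. 0 + f xs) \<in> (\<lambda>h xs. h xs + f xs) ` ?B"
      using equivariant_coboundaries_zero by (rule rev_image_eqI) simp
    ultimately show "f \<in> ?B"
      by simp
  next
    assume f: "f \<in> ?B"
    show "(\<lambda>h xs. h xs + f xs) ` ?B = ?B"
    proof (intro subset_antisym subsetI)
      fix h assume "h \<in> ?B"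
      \<comment> \<open>Write \<open>h\<close> as \<open>(h - f) + f\<close>.\<close>
      then have "(\<lambda>xs. h xs - f xs) \<in> ?B"
        using f by (rule equivariant_coboundaries_diff)
      then show "h \<in> (\<lambda>h xs. h xs + f xs) ` ?B"
        by (rule rev_image_eqI) simp
    qed (use f in \<open>auto intro: equivariant_coboundaries_add\<close>)
  qed
qed

section \<open>Cochains of degree 2 as curried bilinear maps\<close>

lemma equivariant_cochains_2_iff:
  assumes "\<And>xs. length xs \<noteq> 2 \<Longrightarrow> f xs = 0"
  shows "f \<in> equivariant_cochains scale G \<phi> 2
    \<longleftrightarrow> (\<lambda>a b. f [a, b]) \<in> equivariant_bilinear scale G \<phi>"
proof -
  have split: "(\<forall>xs ys. length xs + 1 + length ys = 2 \<longrightarrow> P xs ys)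
    \<longleftrightarrow> (\<forall>a. P [] [a]) \<and> (\<forall>a. P [a] [])" for P :: "'a list \<Rightarrow> 'a list \<Rightarrow> bool"
    unfolding length_split_2 by auto
  have pair: "(\<forall>xs. length xs = 2 \<longrightarrow> P xs) \<longleftrightarrow> (\<forall>a b. P [a, b])" for P :: "'a list \<Rightarrow> bool"
    by (auto simp: eval_nat_numeral length_Suc_conv)
  show ?thesis
    unfolding equivariant_cochains_def hochschild_cochains_def equivariant_bilinear_def
      mem_Collect_eq split pair
    using assms by auto
qed

lemma coboundary_3_iff:
  assumes "\<And>xs. length xs \<noteq> 3 \<Longrightarrow> F xs = 0"
  shows "F \<in> equivariant_coboundaries scale G \<phi> 3 \<longleftrightarrow>
    (\<exists>\<mu>\<in>equivariant_bilinear scale G \<phi>. \<forall>a b c.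
      F [a, b, c] = a * \<mu> b c - \<mu> (a * b) c + \<mu> a (b * c) - \<mu> a b * c)"
    (is "_ \<longleftrightarrow> (\<exists>\<mu>\<in>_. \<forall>a b c. F [a, b, c] = ?d \<mu> a b c)")
proof
  assume "F \<in> equivariant_coboundaries scale G \<phi> 3"
  then obtain f where f: "f \<in> equivariant_cochains scale G \<phi> 2" "F = hochschild_d scale 2 f"
    by (auto simp: equivariant_coboundaries_def)
  have "(\<lambda>a b. f [a, b]) \<in> equivariant_bilinear scale G \<phi>"
    using f(1) by (subst equivariant_cochains_2_iff[symmetric])
      (auto simp: equivariant_cochains_def hochschild_cochains_def)
  then show "\<exists>\<mu>\<in>equivariant_bilinear scale G \<phi>. \<forall>a b c. F [a, b, c] = ?d \<mu> a b c"
    by (rule rev_bexI) (simp add: f(2) hochschild_d_2)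
next
  assume "\<exists>\<mu>\<in>equivariant_bilinear scale G \<phi>. \<forall>a b c. F [a, b, c] = ?d \<mu> a b c"
  then obtain \<mu> where \<mu>: "\<mu> \<in> equivariant_bilinear scale G \<phi>"
    and F: "\<And>a b c. F [a, b, c] = ?d \<mu> a b c"
    by blast
  \<comment> \<open>The cochain on lists that corresponds to \<open>\<mu>\<close>; cochains must be
    0 on lists of the wrong length.\<close>
  define f where "f xs = (case xs of [a, b] \<Rightarrow> \<mu> a b | _ \<Rightarrow> 0)" for xs
  have "f xs = 0" if "length xs \<noteq> 2" for xs
    using that by (auto simp: f_def split: list.splits)
  then have "f \<in> equivariant_cochains scale G \<phi> 2"
    using \<mu> by (subst equivariant_cochains_2_iff) (auto simp: f_def)
  \<comment> \<open>Equality is required on all lists. On triples it is the assumption on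
    \<open>\<mu>\<close>; elsewhere \<open>F\<close> is 0 by hypothesis and the coboundary by
    definition.\<close>
  moreover have "F = hochschild_d scale 2 f"
  proof
    fix xs
    show "F xs = hochschild_d scale 2 f xs"
    proof (cases "length xs = 3")
      case True
      then obtain a b c where "xs = [a, b, c]"
        by (auto simp: length_3_conv)
      then show ?thesis
        by (simp add: hochschild_d_2 F f_def)
    next
      case False
      then show ?thesis
        by (simp add: assms hochschild_d_def)
    qed
  qed
  ultimately show "F \<in> equivariant_coboundaries scale G \<phi> 3"
    by (auto simp: equivariant_coboundaries_def)
qed

section \<open>Associator coefficients as 3-cochains and 3-cocycles\<close>

lemma associator_coeff_cochain:
  assumes m: "\<And>i. m i \<in> equivariant_bilinear scale G \<phi>"
    and F: "\<And>a b c. F [a, b, c] = associator_coeff m r a b c"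
    and F0: "\<And>xs. length xs \<noteq> 3 \<Longrightarrow> F xs = 0"
  shows "F \<in> equivariant_cochains scale G \<phi> 3"
proof -
  have lin: "Vector_Spaces.linear scale scale (\<lambda>x. m i x c)" "Vector_Spaces.linear scale scale (m i a)"
    for i a c
    using m[of i] by (auto simp: equivariant_bilinear_def)
  have add: "m i (x + y) c = m i x c + m i y c" "m i a (x + y) = m i a x + m i a y"
    "m i (scale k x) c = scale k (m i x c)" "m i a (scale k x) = scale k (m i a x)" for i a c x y k
    using lin[of i] by (auto simp: Vector_Spaces.linear_iff)
  have eqv: "m i (\<phi> g a) (\<phi> g b) = \<phi> g (m i a b)" if "g \<in> carrier G" for g i a b
    using m[of i] that by (auto simp: equivariant_bilinear_def)
  have lin3: "Vector_Spaces.linear scale scale (\<lambda>x. associator_coeff m r x b c)"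
    "Vector_Spaces.linear scale scale (\<lambda>x. associator_coeff m r a x c)"
    "Vector_Spaces.linear scale scale (\<lambda>x. associator_coeff m r a b x)" for a b c
    by (simp_all add: Vector_Spaces.linear_iff vector_space_scale associator_coeff_def
        case_prod_unfold add scale_sum_right scale_right_diff_distrib
        sum.distrib[symmetric] algebra_simps)
  have split: "(\<forall>xs ys. length xs + 1 + length ys = 3 \<longrightarrow> P xs ys)
    \<longleftrightarrow> (\<forall>a b. P [] [a, b]) \<and> (\<forall>a b. P [a] [b]) \<and> (\<forall>a b. P [a, b] [])"
    for P :: "'a list \<Rightarrow> 'a list \<Rightarrow> bool"
    unfolding length_split_3 by auto
  have "associator_coeff m r (\<phi> g a) (\<phi> g b) (\<phi> g c) = \<phi> g (associator_coeff m r a b c)"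
    if "g \<in> carrier G" for g a b c
    by (simp add: associator_coeff_def case_prod_unfold eqv[OF that]
        additive.sum[OF act_additive[OF that]] additive.diff[OF act_additive[OF that]])
  then show ?thesis
    unfolding equivariant_cochains_def hochschild_cochains_def mem_Collect_eq split
    by (auto simp: F F0 lin3 length_3_conv)
qed

text \<open>In degree \<open>N\<close> of the pentagon identity, every term with
  \<open>p > 0\<close> contains an associator coefficient of degree \<open>q < N\<close>, which
  vanishes. The remaining term, \<open>p = 0\<close> and \<open>q = N\<close>, is the coboundary of
  \<open>F\<close>, because \<open>m 0\<close> is the product.\<close>

lemma first_associator_coeff_cocycle:
  assumes m: "\<And>i. m i \<in> equivariant_bilinear scale G \<phi>"
    and m0: "m 0 = (\<lambda>a b. a * b)"
    and vanish: "\<And>r a b c. r < N \<Longrightarrow> associator_coeff m r a b c = 0"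
    and F: "\<And>a b c. F [a, b, c] = associator_coeff m N a b c"
    and F0: "\<And>xs. length xs \<noteq> 3 \<Longrightarrow> F xs = 0"
  shows "F \<in> equivariant_cocycles scale G \<phi> 3"
proof -
  have add: "additive (\<lambda>x. m i x c)" "additive (m i a)" for i a c
    using m[of i] by (auto simp: equivariant_bilinear_def intro: linear_imp_additive)
  have "hochschild_d scale 3 F [a, b, c, d] = 0" for a b c d
  proof -
    let ?f = "\<lambda>p q. m p a (associator_coeff m q b c d) - associator_coeff m q (m p a b) c d
      + associator_coeff m q a (m p b c) d - associator_coeff m q a b (m p c d)
      + m p (associator_coeff m q a b c) d"
    have zero: "?f p q = 0" if "p + q = N" "(p, q) \<noteq> (0, N)" for p q
    proof -
      have "q < N"
        using that by auto
      then show ?thesis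
        by (simp add: vanish additive.zero[OF add(1)] additive.zero[OF add(2)])
    qed
    have "hochschild_d scale 3 F [a, b, c, d] = ?f 0 N"
      by (simp add: hochschild_d_3 F m0)
    also have "\<dots> = (\<Sum>(p, q)\<in>{(0, N)}. ?f p q)"
      by simp
    \<comment> \<open>The vanishing terms are added back to reach the full pentagon sum.\<close>
    also have "\<dots> = (\<Sum>(p, q)\<in>{(p, q). p + q = N}. ?f p q)"
    proof (intro sum.mono_neutral_left finite_antidiagonal ballI)
      fix x assume "x \<in> {(p, q). p + q = N} - {(0, N)}"
      then show "(case x of (p, q) \<Rightarrow> ?f p q) = 0"
        using zero[of "fst x" "snd x"] by (simp add: case_prod_unfold prod_eq_iff)
    qed simp
    also have "\<dots> = 0"
      by (rule associator_coeff_pentagon) (rule add)+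
    finally show ?thesis .
  qed
  moreover have "\<exists>a b c d. xs = [a, b, c, d]" if "length xs = 4" for xs :: "'a list"
    using that by (auto simp: eval_nat_numeral length_Suc_conv)
  ultimately have "hochschild_d scale 3 F xs = 0" for xs
    by (cases "length xs = 4") (fastforce, simp add: hochschild_d_def)
  then show ?thesis
    using associator_coeff_cochain[OF m F F0] by (auto simp: equivariant_cocycles_def)
qed

end

section \<open>Extending a deformation\<close>

lemma obstruction_eq_0: "length xs \<noteq> 3 \<Longrightarrow> obstruction n m xs = 0"
  by (auto simp: obstruction_def split: list.splits)

lemma associator_coeff_cong:
  "(\<And>i. i \<le> r \<Longrightarrow> m i = m' i) \<Longrightarrow> associator_coeff m r a b c = associator_coeff m' r a b c"
  unfolding associator_coeff_def by (rule sum.cong) auto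

text \<open>Separates the index pairs \<open>(0, n + 1)\<close> and \<open>(n + 1, 0)\<close>, the
  only ones that involve \<open>m (n + 1)\<close>; the obstruction collects all others.\<close>

lemma associator_coeff_Suc:
  "associator_coeff m (n + 1) a b c = obstruction n m [a, b, c]
    + (m 0 (m (n + 1) a b) c - m 0 a (m (n + 1) b c)
      + (m (n + 1) (m 0 a b) c - m (n + 1) a (m 0 b c)))"
proof -
  let ?I = "{(p, q). p + q = n + 1 \<and> 0 < p \<and> 0 < q}"
  have "{(p, q). p + q = n + 1} = insert (0, n + 1) (insert (n + 1, 0) ?I)"
    by auto
  moreover have "finite ?I"
    by (rule finite_subset[OF _ finite_antidiagonal[of "n + 1"]]) auto
  ultimately show ?thesis
    by (simp add: associator_coeff_def obstruction_def algebra_simps)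
qed

text \<open>Two positive indices with sum \<open>n + 1\<close> are both at most \<open>n\<close>, so
  changing the coefficient of degree \<open>n + 1\<close> leaves the obstruction fixed.\<close>

lemma obstruction_cong:
  assumes "\<And>i. i \<le> n \<Longrightarrow> m i = m' i"
  shows "obstruction n m = obstruction n m'"
  using assms by (auto simp: obstruction_def fun_eq_iff split: list.split intro!: sum.cong)

lemma equivariant_deformation_iff:
  "equivariant_deformation scale G \<phi> n m \<longleftrightarrow>
    m 0 = (\<lambda>a b. a * b) \<and>
    (\<forall>i\<in>{1..n}. m i \<in> equivariant_bilinear scale G \<phi>) \<and>
    (\<forall>r\<le>n. \<forall>a b c. associator_coeff m r a b c = 0)"
  by (simp add: equivariant_deformation_def associator_coeff_def)

text \<open>The associativity conditions up to degree \<open>n\<close> do not see the new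
  coefficient. The single new condition, in degree \<open>n + 1\<close>, says that the obstruction
  minus the coboundary of \<open>\<mu>\<close> is zero.\<close>

lemma equivariant_deformation_extend_iff:
  assumes "equivariant_deformation scale G \<phi> n m"
    and "\<mu> \<in> equivariant_bilinear scale G \<phi>"
  shows "equivariant_deformation scale G \<phi> (n + 1) (m(n + 1 := \<mu>)) \<longleftrightarrow>
    (\<forall>a b c. obstruction n m [a, b, c] = a * \<mu> b c - \<mu> (a * b) c + \<mu> a (b * c) - \<mu> a b * c)"
proof -
  let ?m = "m(n + 1 := \<mu>)"
  have m0: "m 0 = (\<lambda>a b. a * b)"
    using assms(1) by (simp add: equivariant_deformation_iff)
  have low: "associator_coeff ?m r a b c = 0" if "r \<le> n" for r a b c
    using assms(1) that associator_coeff_cong[of r ?m m a b c]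
    by (simp add: equivariant_deformation_iff)
  have "associator_coeff ?m (n + 1) a b c = obstruction n m [a, b, c]
    - (a * \<mu> b c - \<mu> (a * b) c + \<mu> a (b * c) - \<mu> a b * c)" for a b c
    unfolding associator_coeff_Suc using obstruction_cong[of n ?m m] m0 by simp
  moreover have "equivariant_deformation scale G \<phi> (n + 1) ?m
    \<longleftrightarrow> (\<forall>a b c. associator_coeff ?m (n + 1) a b c = 0)"
    using assms low by (auto simp: equivariant_deformation_iff le_Suc_eq)
  ultimately show ?thesis
    by simp
qed

theorem theorem4p8:
  fixes scale :: "'k::field_char_0 \<Rightarrow> 'a::ring \<Rightarrow> 'a"
    and G :: "('g, 'b) monoid_scheme"
    and \<phi> :: "'g \<Rightarrow> 'a \<Rightarrow> 'a"
    and n :: nat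
    and m :: "nat \<Rightarrow> 'a \<Rightarrow> 'a \<Rightarrow> 'a"
  assumes "algebra_action scale G \<phi>"
    and "finite (carrier G)"
    and "n \<ge> 1"
    and "equivariant_deformation scale G \<phi> n m"
  shows "obstruction n m \<in> equivariant_cocycles scale G \<phi> 3 \<and>
    ((\<exists>\<mu>\<in>equivariant_bilinear scale G \<phi>.
        equivariant_deformation scale G \<phi> (n + 1) (m(n + 1 := \<mu>)))
     \<longleftrightarrow> cohomology_class scale G \<phi> 3 (obstruction n m) = \<one>\<^bsub>equivariant_cohomology scale G \<phi> 3\<^esub>)"
proof
  interpret algebra_action scale G \<phi>
    by (rule assms(1))
  \<comment> \<open>The values of \<open>m\<close> above \<open>n\<close> are arbitrary. Replacing
    them by zero makes every coefficient equivariant and bilinear, as the pentagon argument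
    requires, and preserves both the conditions up to degree \<open>n\<close> and the
    obstruction.\<close>
  define M where "M i = (if i \<le> n then m i else (\<lambda>a b. 0))" for i
  have M0: "M 0 = (\<lambda>a b. a * b)"
    using assms(4) by (simp add: M_def equivariant_deformation_iff)
  have M: "M i \<in> equivariant_bilinear scale G \<phi>" for i
    using assms(4) times_equivariant_bilinear zero_equivariant_bilinear
    by (cases "i = 0") (auto simp: M_def equivariant_deformation_iff)
  show "obstruction n m \<in> equivariant_cocycles scale G \<phi> 3"
  proof (rule first_associator_coeff_cocycle[of M, OF M M0])
    show "associator_coeff M r a b c = 0" if "r < n + 1" for r a b c
      using assms(4) that associator_coeff_cong[of r M m a b c]
      by (simp add: M_def equivariant_deformation_iff)
    show "obstruction n m [a, b, c] = associator_coeff M (n + 1) a b c" for a b c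
      \<comment> \<open>Since \<open>M (n + 1)\<close> is zero, the boundary terms vanish and the
        obstruction alone remains. \<open>M 0\<close> is first turned into the product, then
        \<open>M (n + 1)\<close> is evaluated.\<close>
      unfolding associator_coeff_Suc using obstruction_cong[of n m M]
      by (simp add: M0) (simp add: M_def)
  qed (rule obstruction_eq_0)
  show "(\<exists>\<mu>\<in>equivariant_bilinear scale G \<phi>.
      equivariant_deformation scale G \<phi> (n + 1) (m(n + 1 := \<mu>)))
    \<longleftrightarrow> cohomology_class scale G \<phi> 3 (obstruction n m) = \<one>\<^bsub>equivariant_cohomology scale G \<phi> 3\<^esub>"
    \<comment> \<open>Both sides become the existence of an equivariant bilinear
      \<open>\<mu>\<close> whose coboundary is the obstruction.\<close>
    using equivariant_deformation_extend_iff[OF assms(4)]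
    by (simp add: cohomology_class_eq_one_iff coboundary_3_iff[OF obstruction_eq_0] cong: bex_cong)
qed

end
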